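(* Let $G=(V,w,m)$ be a graph. Let $x_0\in V$ and suppose that, for some $K\in\mathbb R$, $\kappa(x_0,y)\ge K$ for all $y\in V\setminus\{x_0\}$. Then $$\Delta d(x_0,\cdot)\le\mathrm{Deg}(x_0)-K\,d(x_0,\cdot)$$ pointwise on $V$.
   Context: A graph is a triple $G=(V,w,m)$ with $V$ a countable set, $w:V\times V\to[0,\infty)$ symmetric and zero on the diagonal, and $m:V\to(0,\infty)$. Write $x\sim y$ if $w(x,y)>0$. All graphs are locally finite (for each $x$ only finitely many $y$ satisfy $x\sim y$) and connected; $d(x,y)=\inf\{n: x=x_0\sim\cdots\sim x_n=y\}$ is the combinatorial distance, which is finite by connectedness. The Laplacian is $\Delta f(x)=\frac1{m(x)}\sum_{y\in V}w(x,y)(f(y)-f(x))$, and $\mathrm{Deg}(x)=\frac1{m(x)}\sum_{y}w(x,y)$. $Lip(1)$ is the set of $f:V\to\mathbb R$ with $|f(x)-f(y)|\le d(x,y)$ for all $x,y$. Curvature: for $x\in V$ and $\varepsilon>0$ let $m_x^\varepsilon(x)=1-\varepsilon\,\mathrm{Deg}(x)$ and $m_x^\varepsilon(y)=\varepsilon w(x,y)/m(x)$ for $y\neq x$; this is a finitely supported probability measure for $\varepsilon$ small. For probability measures $\mu,\nu$ on $V$, $W(\mu,\nu)=\sup_{f}\sum_{x}f(x)(\mu(x)-\nu(x))$, the supremum over bounded $f\in Lip(1)$. For $x\neq y$ let $\kappa_\varepsilon(x,y)=1-\frac{W(m_x^\varepsilon,m_y^\varepsilon)}{d(x,y)}$ and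 $\kappa(x,y)=\lim_{\varepsilon\to0^+}\frac1\varepsilon\kappa_\varepsilon(x,y)$ (this limit exists). *)

theory Defs
  imports "HOL-Analysis.Analysis"
begin

text \<open>
  Locally finite, connected weighted graphs on a countable vertex set \<open>V\<close>. The weights \<open>w\<close> and
  \<open>m\<close> are total functions on the ambient type; only their values on \<open>V\<close> are constrained and used.
\<close>

definition adj :: "'a set \<Rightarrow> ('a \<Rightarrow> 'a \<Rightarrow> real) \<Rightarrow> 'a \<Rightarrow> 'a \<Rightarrow> bool" where
  "adj V w x y \<longleftrightarrow> x \<in> V \<and> y \<in> V \<and> w x y > 0"

locale weighted_graph =
  fixes V :: "'a set" and w :: "'a \<Rightarrow> 'a \<Rightarrow> real" and m :: "'a \<Rightarrow> real"
  assumes countable_V: "countable V"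
    and w_nonneg: "\<And>x y. x \<in> V \<Longrightarrow> y \<in> V \<Longrightarrow> w x y \<ge> 0"
    and w_sym: "\<And>x y. x \<in> V \<Longrightarrow> y \<in> V \<Longrightarrow> w x y = w y x"
    and w_diag: "\<And>x. x \<in> V \<Longrightarrow> w x x = 0"
    and m_pos: "\<And>x. x \<in> V \<Longrightarrow> m x > 0"
    and locally_finite: "\<And>x. x \<in> V \<Longrightarrow> finite {y. adj V w x y}"
    and connected: "\<And>x y. x \<in> V \<Longrightarrow> y \<in> V \<Longrightarrow> (adj V w)\<^sup>*\<^sup>* x y"

text \<open>
  \<open>(adj V w ^^ n) x y\<close> says that there is a walk with \<open>n\<close> steps from \<open>x\<close> to \<open>y\<close>.
\<close>

definition cdist :: "'a set \<Rightarrow> ('a \<Rightarrow> 'a \<Rightarrow> real) \<Rightarrow> 'a \<Rightarrow> 'a \<Rightarrow> nat" where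
  "cdist V w x y = Inf {n. (adj V w ^^ n) x y}"

text \<open>
  The infinite sums in the next two definitions have finite support by local finiteness.
\<close>

definition laplacian ::
  "'a set \<Rightarrow> ('a \<Rightarrow> 'a \<Rightarrow> real) \<Rightarrow> ('a \<Rightarrow> real) \<Rightarrow> ('a \<Rightarrow> real) \<Rightarrow> 'a \<Rightarrow> real" where
  "laplacian V w m f x = 1 / m x * (\<Sum>\<^sub>\<infinity>y\<in>V. w x y * (f y - f x))"

definition Deg :: "'a set \<Rightarrow> ('a \<Rightarrow> 'a \<Rightarrow> real) \<Rightarrow> ('a \<Rightarrow> real) \<Rightarrow> 'a \<Rightarrow> real" where
  "Deg V w m x = 1 / m x * (\<Sum>\<^sub>\<infinity>y\<in>V. w x y)"

definition Lip1 :: "'a set \<Rightarrow> ('a \<Rightarrow> 'a \<Rightarrow> real) \<Rightarrow> ('a \<Rightarrow> real) set" where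
  "Lip1 V w = {f. \<forall>x\<in>V. \<forall>y\<in>V. \<bar>f x - f y\<bar> \<le> real (cdist V w x y)}"

text \<open>
  Measures on \<open>V\<close> are given by their point masses. The supremum is taken in \<open>real\<close>: it is over a
  nonempty set, which is bounded above whenever \<open>\<mu>\<close> and \<open>\<nu>\<close> are finitely supported with equal
  total mass, as is the case below.
\<close>

definition wasserstein ::
  "'a set \<Rightarrow> ('a \<Rightarrow> 'a \<Rightarrow> real) \<Rightarrow> ('a \<Rightarrow> real) \<Rightarrow> ('a \<Rightarrow> real) \<Rightarrow> real" where
  "wasserstein V w \<mu> \<nu> =
     (SUP f \<in> {f \<in> Lip1 V w. bounded (f ` V)}. \<Sum>\<^sub>\<infinity>x\<in>V. f x * (\<mu> x - \<nu> x))"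

definition rw_measure ::
  "'a set \<Rightarrow> ('a \<Rightarrow> 'a \<Rightarrow> real) \<Rightarrow> ('a \<Rightarrow> real) \<Rightarrow> real \<Rightarrow> 'a \<Rightarrow> 'a \<Rightarrow> real" where
  "rw_measure V w m \<epsilon> x y =
     (if y = x then 1 - \<epsilon> * Deg V w m x else \<epsilon> * w x y / m x)"

definition curvature_eps ::
  "'a set \<Rightarrow> ('a \<Rightarrow> 'a \<Rightarrow> real) \<Rightarrow> ('a \<Rightarrow> real) \<Rightarrow> real \<Rightarrow> 'a \<Rightarrow> 'a \<Rightarrow> real" where
  "curvature_eps V w m \<epsilon> x y =
     1 - wasserstein V w (rw_measure V w m \<epsilon> x) (rw_measure V w m \<epsilon> y) / real (cdist V w x y)"

text \<open>
  The curvature is meaningful for distinct \<open>x\<close> and \<open>y\<close> in \<open>V\<close>; the limit then exists, since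
  \<open>\<epsilon> \<mapsto> curvature_eps V w m \<epsilon> x y\<close> is concave, vanishes at \<open>0\<close>, and is bounded above by a
  constant multiple of \<open>\<epsilon>\<close>. Only small \<open>\<epsilon> > 0\<close>, for which \<open>rw_measure\<close> is a probability
  measure, matter for it.
\<close>

definition curvature ::
  "'a set \<Rightarrow> ('a \<Rightarrow> 'a \<Rightarrow> real) \<Rightarrow> ('a \<Rightarrow> real) \<Rightarrow> 'a \<Rightarrow> 'a \<Rightarrow> real" where
  "curvature V w m x y = Lim (at_right 0) (\<lambda>\<epsilon>. 1 / \<epsilon> * curvature_eps V w m \<epsilon> x y)"

end

theory Submission imports Defs begin

text \<open>
  Testing the transport distance against the truncated function \<open>- min (d x\<^sub>0) (d x\<^sub>0 y + 1)\<close> gives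
  \<open>W \<ge> d x\<^sub>0 y + \<epsilon> (\<Delta> (d x\<^sub>0) y - Deg x\<^sub>0)\<close>, hence
  \<open>\<kappa>\<^sub>\<epsilon> x\<^sub>0 y / \<epsilon> \<le> (Deg x\<^sub>0 - \<Delta> (d x\<^sub>0) y) / d x\<^sub>0 y\<close> for every \<open>\<epsilon> > 0\<close>. The limit defining the
  curvature exists and inherits this bound: \<open>W\<close> is a supremum of functions \<open>\<epsilon> \<mapsto> a + \<epsilon> b\<close> with
  \<open>a \<le> d x\<^sub>0 y\<close>, so \<open>\<kappa>\<^sub>\<epsilon> / \<epsilon>\<close> is an infimum of the functions \<open>((d x\<^sub>0 y - a) / \<epsilon> - b) / d x\<^sub>0 y\<close>,
  which decrease in \<open>\<epsilon>\<close>.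
\<close>

section \<open>One-sided limits of decreasing functions\<close>

text \<open>A value above \<open>c\<close> at \<open>t\<close> persists at all points between
  \<open>a\<close> and \<open>t\<close>, so the values approach their supremum, which is finite by
  \<open>B\<close>.\<close>

lemma antimono_bounded_tendsto_at_right:
  fixes h :: "real \<Rightarrow> real"
  assumes anti: "\<And>s t. a < s \<Longrightarrow> s \<le> t \<Longrightarrow> h t \<le> h s"
    and bound: "\<And>s. a < s \<Longrightarrow> h s \<le> B"
  shows "(h \<longlongrightarrow> (SUP s\<in>{a<..}. h s)) (at_right a)"
proof (rule order_tendstoI)
  have bdd: "bdd_above (h ` {a<..})"
    using bound by (intro bdd_aboveI2[of _ _ B]) simp
  fix c assume "c < (SUP s\<in>{a<..}. h s)"
  then obtain t where "a < t" "c < h t"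
    using bdd by (auto simp: less_cSUP_iff)
  then show "\<forall>\<^sub>F s in at_right a. c < h s"
    using anti by (auto simp: eventually_at_right intro!: exI[of _ t] less_le_trans[of c "h t"])
next
  have bdd: "bdd_above (h ` {a<..})"
    using bound by (intro bdd_aboveI2[of _ _ B]) simp
  fix c assume c: "(SUP s\<in>{a<..}. h s) < c"
  have "h s < c" if "a < s" for s
    using cSUP_upper[OF _ bdd, of s] that c by simp
  then show "\<forall>\<^sub>F s in at_right a. h s < c"
    by (intro eventually_at_rightI[of a "a + 1"]) auto
qed

context weighted_graph
begin

section \<open>The combinatorial distance as a metric\<close>

lemma adj_sym: "adj V w x y \<Longrightarrow> adj V w y x"
  using w_sym[of x y] by (simp add: adj_def)

lemma walk_sym: "(adj V w ^^ n) x y \<Longrightarrow> (adj V w ^^ n) y x"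
proof (induction n arbitrary: y)
  case (Suc n)
  then obtain z where "(adj V w ^^ n) x z" "adj V w z y" by auto
  then show ?case
    using Suc.IH adj_sym by (blast intro: relpowp_Suc_I2)
qed auto

lemma cdist_sym: "cdist V w x y = cdist V w y x"
proof -
  have "{n. (adj V w ^^ n) x y} = {n. (adj V w ^^ n) y x}"
    using walk_sym by blast
  then show ?thesis by (simp add: cdist_def)
qed

lemma cdist_le: "(adj V w ^^ n) x y \<Longrightarrow> cdist V w x y \<le> n"
  unfolding cdist_def by (rule cInf_lower) auto

text \<open>Connectedness makes the set of walk lengths nonempty, so its infimum in the naturals is
  attained by an actual walk.\<close>

lemma walk_cdist:
  assumes "x \<in> V" "y \<in> V"
  shows "(adj V w ^^ cdist V w x y) x y"
proof -
  have "{n. (adj V w ^^ n) x y} \<noteq> {}"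
    using rtranclp_imp_relpowp[OF connected[OF assms]] by blast
  then show ?thesis
    unfolding cdist_def using Inf_nat_def1[of "{n. (adj V w ^^ n) x y}"] by simp
qed

lemma cdist_triangle:
  assumes "x \<in> V" "y \<in> V" "z \<in> V"
  shows "cdist V w x z \<le> cdist V w x y + cdist V w y z"
proof (rule cdist_le)
  show "(adj V w ^^ (cdist V w x y + cdist V w y z)) x z"
    unfolding relpowp_add
    using walk_cdist[OF assms(1,2)] walk_cdist[OF assms(2,3)] by (rule relcomppI)
qed

lemma cdist_self [simp]: "cdist V w x x = 0"
  using cdist_le[of 0 x x] by simp

lemma cdist_eq_0_iff: "x \<in> V \<Longrightarrow> y \<in> V \<Longrightarrow> cdist V w x y = 0 \<longleftrightarrow> x = y"
  using walk_cdist[of x y] by auto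

lemma cdist_adj:
  assumes "adj V w x y"
  shows "cdist V w x y = 1"
proof -
  \<comment> \<open>The vanishing diagonal of \<open>w\<close> excludes loops, and so distance
    0.\<close>
  have "x \<in> V" "y \<in> V" "x \<noteq> y"
    using assms w_diag by (auto simp: adj_def)
  moreover have "cdist V w x y \<le> 1"
    using assms by (intro cdist_le) (simp add: relcompp_apply)
  ultimately show ?thesis
    using cdist_eq_0_iff by (metis le_neq_implies_less less_one)
qed

section \<open>Lipschitz functions and the Laplacian\<close>

text \<open>The transport distance admits only bounded test functions; capping the distance at a
  constant gives boundedness from above and does not enlarge increments.\<close>

lemma Lip1_truncated_cdist:
  assumes "x \<in> V"
  shows "(\<lambda>z. min (real (cdist V w x z)) R) \<in> Lip1 V w"
proof -
  have "\<bar>min (real (cdist V w x y)) R - min (real (cdist V w x z)) R\<bar> \<le> real (cdist V w y z)"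
    if "y \<in> V" "z \<in> V" for y z
    using cdist_triangle[OF assms that] cdist_triangle[OF assms that(2,1)] cdist_sym[of y z]
    by linarith
  then show ?thesis by (simp add: Lip1_def)
qed

lemma Lip1_uminus: "f \<in> Lip1 V w \<Longrightarrow> (\<lambda>z. - f z) \<in> Lip1 V w"
  by (simp add: Lip1_def abs_minus_commute)

text \<open>The weight \<open>w x y\<close> vanishes off the finitely many neighbours of
  \<open>x\<close>. The free factor \<open>g\<close> serves both the Laplacian and, with
  \<open>g = 1\<close>, the degree.\<close>

lemma weighted_has_sum:
  assumes "x \<in> V"
  shows "((\<lambda>y. w x y * g y) has_sum (\<Sum>y | adj V w x y. w x y * g y)) V"
proof -
  have "((\<lambda>y. w x y * g y) has_sum (\<Sum>y | adj V w x y. w x y * g y)) {y. adj V w x y}"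
    using locally_finite[OF assms] by (rule has_sum_finite)
  moreover have "((\<lambda>y. w x y * g y) has_sum s) {y. adj V w x y} \<longleftrightarrow>
      ((\<lambda>y. w x y * g y) has_sum s) V" for s
  proof (rule has_sum_cong_neutral)
    show "w x y * g y = 0" if "y \<in> V - {y. adj V w x y}" for y
      using that assms w_nonneg[of x y] by (auto simp: adj_def)
  qed (auto simp: adj_def)
  ultimately show ?thesis by blast
qed

lemma laplacian_eq_sum:
  "x \<in> V \<Longrightarrow> laplacian V w m f x = 1 / m x * (\<Sum>y | adj V w x y. w x y * (f y - f x))"
  unfolding laplacian_def by (simp add: infsumI[OF weighted_has_sum])

lemma Deg_eq_sum: "x \<in> V \<Longrightarrow> Deg V w m x = 1 / m x * (\<Sum>y | adj V w x y. w x y)"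
  unfolding Deg_def using infsumI[OF weighted_has_sum[of x "\<lambda>_. 1"]] by simp

text \<open>The Laplacian is local, so a truncation far enough out does not change it.\<close>

lemma laplacian_cong:
  assumes "x \<in> V" "f x = g x" "\<And>y. adj V w x y \<Longrightarrow> f y = g y"
  shows "laplacian V w m f x = laplacian V w m g x"
  using assms by (simp add: laplacian_eq_sum)

lemma laplacian_uminus:
  assumes "x \<in> V"
  shows "laplacian V w m (\<lambda>z. - f z) x = - laplacian V w m f x"
proof -
  have "w x y * (- f y - - f x) = - (w x y * (f y - f x))" for y
    by (simp add: algebra_simps)
  then show ?thesis
    using assms by (simp only: laplacian_eq_sum sum_negf mult_minus_right)
qed

text \<open>Neighbours are at distance 1, so each increment is at most 1. Applied to
  \<open>f\<close> and \<open>- f\<close>, this bounds the supremum defining the transport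
  distance.\<close>

lemma laplacian_Lip1_le:
  assumes "x \<in> V" "f \<in> Lip1 V w"
  shows "laplacian V w m f x \<le> Deg V w m x"
proof -
  have "(\<Sum>y | adj V w x y. w x y * (f y - f x)) \<le> (\<Sum>y | adj V w x y. w x y)"
  proof (rule sum_mono)
    fix y assume y: "y \<in> {y. adj V w x y}"
    then have "\<bar>f y - f x\<bar> \<le> real (cdist V w y x)"
      using assms by (auto simp: Lip1_def adj_def)
    then have "f y - f x \<le> 1"
      using y cdist_adj[of x y] cdist_sym[of x y] by auto
    then show "w x y * (f y - f x) \<le> w x y"
      using y by (auto simp: adj_def mult_left_le)
  qed
  then show ?thesis
    using m_pos[OF assms(1)] assms(1)
    by (simp add: laplacian_eq_sum Deg_eq_sum divide_right_mono)
qed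

section \<open>Transport distance between random walk measures\<close>

text \<open>Integration against the walk measure is evaluation at \<open>x\<close> of
  \<open>f + \<epsilon> * \<Delta> f\<close>. The identity is algebraic and holds for every real
  \<open>\<epsilon>\<close>, even when the point mass at \<open>x\<close> is negative.\<close>

lemma rw_measure_has_sum:
  assumes "x \<in> V"
  shows "((\<lambda>z. f z * rw_measure V w m \<epsilon> x z) has_sum (f x + \<epsilon> * laplacian V w m f x)) V"
proof -
  \<comment> \<open>The measure is split into its atom at \<open>x\<close> and the jump part; as
    \<open>w x x = 0\<close>, the two do not overlap.\<close>
  have "((\<lambda>z. if z = x then f x * (1 - \<epsilon> * Deg V w m x) else 0) has_sum
      f x * (1 - \<epsilon> * Deg V w m x)) V"
    using assms has_sum_cong_neutral[of V "{x}"
        "\<lambda>z. if z = x then f x * (1 - \<epsilon> * Deg V w m x) else 0"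
        "\<lambda>z. f x * (1 - \<epsilon> * Deg V w m x)"] has_sum_finite[of "{x}"] by fastforce
  moreover have "((\<lambda>z. \<epsilon> / m x * (w x z * f z)) has_sum
      \<epsilon> / m x * (\<Sum>y | adj V w x y. w x y * f y)) V"
    by (intro has_sum_cmult_right weighted_has_sum assms)
  ultimately have "((\<lambda>z. (if z = x then f x * (1 - \<epsilon> * Deg V w m x) else 0) +
      \<epsilon> / m x * (w x z * f z)) has_sum
      f x * (1 - \<epsilon> * Deg V w m x) + \<epsilon> / m x * (\<Sum>y | adj V w x y. w x y * f y)) V"
    by (rule has_sum_add)
  moreover have "(if z = x then f x * (1 - \<epsilon> * Deg V w m x) else 0) + \<epsilon> / m x * (w x z * f z) =
      f z * rw_measure V w m \<epsilon> x z" for z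
    using w_diag[OF assms] by (simp add: rw_measure_def)
  moreover have "f x * (1 - \<epsilon> * Deg V w m x) + \<epsilon> / m x * (\<Sum>y | adj V w x y. w x y * f y) =
      f x + \<epsilon> * laplacian V w m f x"
  proof -
    have "(\<Sum>y | adj V w x y. w x y * (f y - f x)) =
        (\<Sum>y | adj V w x y. w x y * f y) - (\<Sum>y | adj V w x y. w x y) * f x"
      by (simp add: right_diff_distrib sum_subtractf sum_distrib_right)
    then show ?thesis
      using assms by (simp add: Deg_eq_sum laplacian_eq_sum diff_divide_distrib right_diff_distrib)
  qed
  ultimately show ?thesis by simp
qed

lemma wasserstein_rw_measure:
  assumes "x \<in> V" "y \<in> V"
  shows "wasserstein V w (rw_measure V w m \<epsilon> x) (rw_measure V w m \<epsilon> y) =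
    (SUP f \<in> {f \<in> Lip1 V w. bounded (f ` V)}.
      f x - f y + \<epsilon> * (laplacian V w m f x - laplacian V w m f y))"
proof -
  have "(\<Sum>\<^sub>\<infinity>z\<in>V. f z * (rw_measure V w m \<epsilon> x z - rw_measure V w m \<epsilon> y z)) =
      f x - f y + \<epsilon> * (laplacian V w m f x - laplacian V w m f y)" for f
  proof (rule infsumI)
    show "((\<lambda>z. f z * (rw_measure V w m \<epsilon> x z - rw_measure V w m \<epsilon> y z)) has_sum
      f x - f y + \<epsilon> * (laplacian V w m f x - laplacian V w m f y)) V"
      using has_sum_add[OF rw_measure_has_sum[OF assms(1), of f \<epsilon>]
          rw_measure_has_sum[OF assms(2), of "\<lambda>z. - f z" \<epsilon>]]
      by (simp add: laplacian_uminus[OF assms(2)] algebra_simps)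
  qed
  then show ?thesis by (simp add: wasserstein_def)
qed

lemma wasserstein_rw_measure_ge:
  assumes "x \<in> V" "y \<in> V" "f \<in> Lip1 V w" "bounded (f ` V)" "\<epsilon> \<ge> 0"
  shows "f x - f y + \<epsilon> * (laplacian V w m f x - laplacian V w m f y) \<le>
    wasserstein V w (rw_measure V w m \<epsilon> x) (rw_measure V w m \<epsilon> y)"
  unfolding wasserstein_rw_measure[OF assms(1,2)]
proof (rule cSUP_upper)
  show "bdd_above ((\<lambda>f. f x - f y + \<epsilon> * (laplacian V w m f x - laplacian V w m f y)) `
      {f \<in> Lip1 V w. bounded (f ` V)})"
  proof (rule bdd_aboveI2)
    fix g assume "g \<in> {f \<in> Lip1 V w. bounded (f ` V)}"
    then have g: "g \<in> Lip1 V w" by simp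
    have "g x - g y \<le> real (cdist V w x y)"
      using g assms by (force simp: Lip1_def)
    moreover have "laplacian V w m g x - laplacian V w m g y \<le> Deg V w m x + Deg V w m y"
      using laplacian_Lip1_le[OF assms(1) g] laplacian_Lip1_le[OF assms(2) Lip1_uminus[OF g]]
        laplacian_uminus[OF assms(2)] by simp
    ultimately show "g x - g y + \<epsilon> * (laplacian V w m g x - laplacian V w m g y) \<le>
        real (cdist V w x y) + \<epsilon> * (Deg V w m x + Deg V w m y)"
      using assms(5) by (intro add_mono mult_left_mono)
  qed
qed (use assms in auto)

section \<open>Monotonicity of the curvature quotient and the bound on its limit\<close>

lemma curvature_eps_quotient_antimono:
  assumes "x \<in> V" "y \<in> V" "x \<noteq> y" "0 < s" "s \<le> t"
  shows "1 / t * curvature_eps V w m t x y \<le> 1 / s * curvature_eps V w m s x y"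
proof -
  define W where "W \<epsilon> = wasserstein V w (rw_measure V w m \<epsilon> x) (rw_measure V w m \<epsilon> y)" for \<epsilon>
  define d where "d = real (cdist V w x y)"
  have d: "d > 0"
    using assms cdist_eq_0_iff[of x y] by (simp add: d_def)
  \<comment> \<open>Each test value is affine in \<open>\<epsilon>\<close>, so at \<open>s\<close>
    it is the convex combination of its values at 0 and \<open>t\<close> with weights
    \<open>(t - s) / t\<close> and \<open>s / t\<close>. At 0 it is at most \<open>d\<close>, at
    \<open>t\<close> at most \<open>W t\<close>.\<close>
  have "W s \<le> ((t - s) * d + s * W t) / t"
    unfolding W_def wasserstein_rw_measure[OF assms(1,2), of s]
  proof (rule cSUP_least)
    have "(\<lambda>_. 0) \<in> {f \<in> Lip1 V w. bounded (f ` V)}"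
      by (auto simp: Lip1_def intro!: finite_imp_bounded finite_subset[of _ "{0}"])
    then show "{f \<in> Lip1 V w. bounded (f ` V)} \<noteq> {}" by blast
  next
    fix f assume f: "f \<in> {f \<in> Lip1 V w. bounded (f ` V)}"
    define b where "b = laplacian V w m f x - laplacian V w m f y"
    have "f x - f y \<le> d"
      using f assms by (force simp: Lip1_def d_def)
    then have "(t - s) * (f x - f y) \<le> (t - s) * d"
      using assms by (intro mult_left_mono) auto
    moreover have "s * (f x - f y + t * b) \<le> s * W t"
      unfolding W_def b_def using f assms by (intro mult_left_mono wasserstein_rw_measure_ge) auto
    ultimately have "t * (f x - f y + s * b) \<le> (t - s) * d + s * W t"
      by (simp add: algebra_simps)
    then show "f x - f y + s * (laplacian V w m f x - laplacian V w m f y) \<le>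
        ((t - s) * d + s * wasserstein V w (rw_measure V w m t x) (rw_measure V w m t y)) / t"
      using assms by (simp add: b_def W_def pos_le_divide_eq mult.commute)
  qed
  then have "t * W s \<le> (t - s) * d + s * W t"
    using assms by (simp add: pos_le_divide_eq mult.commute)
  then have "s * (d - W t) \<le> t * (d - W s)"
    by (simp add: algebra_simps)
  then have "(d - W t) / (t * d) \<le> (d - W s) / (s * d)"
    using assms d by (simp add: divide_simps) (simp add: algebra_simps)
  moreover have "1 / \<epsilon> * curvature_eps V w m \<epsilon> x y = (d - W \<epsilon>) / (\<epsilon> * d)" if "\<epsilon> > 0" for \<epsilon>
    using d that by (simp add: curvature_eps_def W_def d_def field_simps)
  ultimately show ?thesis using assms by simp
qed

lemma laplacian_cdist_self:
  assumes "x \<in> V"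
  shows "laplacian V w m (\<lambda>z. real (cdist V w x z)) x = Deg V w m x"
  using assms by (simp add: laplacian_eq_sum Deg_eq_sum cdist_adj)

lemma curvature_eps_quotient_le:
  assumes "x \<in> V" "y \<in> V" "x \<noteq> y" "\<epsilon> > 0"
  shows "1 / \<epsilon> * curvature_eps V w m \<epsilon> x y \<le>
    (Deg V w m x - laplacian V w m (\<lambda>z. real (cdist V w x z)) y) / real (cdist V w x y)"
proof -
  define W where "W = wasserstein V w (rw_measure V w m \<epsilon> x) (rw_measure V w m \<epsilon> y)"
  define d where "d = real (cdist V w x y)"
  define L where "L = laplacian V w m (\<lambda>z. real (cdist V w x z)) y"
  \<comment> \<open>The cap \<open>d + 1\<close> is the largest distance from \<open>x\<close> that
    a neighbour of \<open>y\<close> can have, and it exceeds 1. Hence \<open>f\<close> agrees with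
    the distance at \<open>x\<close>, at \<open>y\<close> and at all their neighbours.\<close>
  define f where "f = (\<lambda>z. min (real (cdist V w x z)) (d + 1))"
  have d: "d > 0"
    using assms cdist_eq_0_iff[of x y] by (simp add: d_def)
  have "laplacian V w m f x = Deg V w m x"
    using assms d laplacian_cdist_self[OF assms(1)]
    by (subst laplacian_cong[of x f "\<lambda>z. real (cdist V w x z)"]) (auto simp: f_def cdist_adj)
  moreover have "laplacian V w m f y = L"
    unfolding L_def
  proof (rule laplacian_cong)
    fix z assume z: "adj V w y z"
    then have "real (cdist V w x z) \<le> d + 1"
      using cdist_triangle[of x y z] cdist_adj[OF z] assms by (auto simp: d_def adj_def)
    then show "f z = real (cdist V w x z)" by (simp add: f_def)
  qed (use assms in \<open>auto simp: f_def d_def\<close>)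
  moreover have "f x = 0" "f y = d"
    using d by (auto simp: f_def d_def)
  moreover have "bounded ((\<lambda>z. - f z) ` V)"
    using d by (intro boundedI[of _ "d + 1"]) (auto simp: f_def)
  \<comment> \<open>The sign in \<open>- f\<close> makes the difference of its values at
    \<open>x\<close> and \<open>y\<close> equal to \<open>+ d\<close>.\<close>
  ultimately have "d + \<epsilon> * (L - Deg V w m x) \<le> W"
    using wasserstein_rw_measure_ge[of x y "\<lambda>z. - f z" \<epsilon>] assms
      Lip1_uminus[of f] Lip1_truncated_cdist[of x "d + 1"]
    by (simp add: f_def[symmetric] W_def laplacian_uminus)
  then have "(d - W) / (\<epsilon> * d) \<le> \<epsilon> * (Deg V w m x - L) / (\<epsilon> * d)"
    using assms d by (intro divide_right_mono) (auto simp: algebra_simps)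
  moreover have "1 / \<epsilon> * curvature_eps V w m \<epsilon> x y = (d - W) / (\<epsilon> * d)"
    using d assms by (simp add: curvature_eps_def W_def d_def field_simps)
  ultimately show ?thesis
    using assms by (simp add: L_def d_def)
qed

lemma curvature_le:
  assumes "x \<in> V" "y \<in> V" "x \<noteq> y"
  shows "curvature V w m x y \<le>
    (Deg V w m x - laplacian V w m (\<lambda>z. real (cdist V w x z)) y) / real (cdist V w x y)"
proof -
  let ?h = "\<lambda>\<epsilon>. 1 / \<epsilon> * curvature_eps V w m \<epsilon> x y"
  have "(?h \<longlongrightarrow> (SUP \<epsilon>\<in>{0<..}. ?h \<epsilon>)) (at_right 0)"
    using curvature_eps_quotient_antimono[OF assms] curvature_eps_quotient_le[OF assms]
    by (rule antimono_bounded_tendsto_at_right)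
  \<comment> \<open>Convergence must come first: \<open>Lim\<close> names the limit only once one is
    known to exist.\<close>
  then have "curvature V w m x y = (SUP \<epsilon>\<in>{0<..}. ?h \<epsilon>)"
    unfolding curvature_def by (intro tendsto_Lim) auto
  also have "\<dots> \<le> (Deg V w m x - laplacian V w m (\<lambda>z. real (cdist V w x z)) y) /
      real (cdist V w x y)"
    using curvature_eps_quotient_le[OF assms] by (intro cSUP_least) auto
  finally show ?thesis .
qed

end

theorem theorem4p1:
  fixes V :: "'a set" and w :: "'a \<Rightarrow> 'a \<Rightarrow> real" and m :: "'a \<Rightarrow> real"
    and x0 :: 'a and K :: real
  assumes "weighted_graph V w m"
    and "x0 \<in> V"
    and "\<forall>y \<in> V - {x0}. curvature V w m x0 y \<ge> K"
  shows "\<forall>x \<in> V. laplacian V w m (\<lambda>y. real (cdist V w x0 y)) x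
                   \<le> Deg V w m x0 - K * real (cdist V w x0 x)"
proof
  interpret weighted_graph V w m by fact
  fix x assume x: "x \<in> V"
  show "laplacian V w m (\<lambda>y. real (cdist V w x0 y)) x \<le> Deg V w m x0 - K * real (cdist V w x0 x)"
  proof (cases "x = x0")
    \<comment> \<open>No curvature bound is available at \<open>x0\<close>; there the distance is 0
      and equality holds.\<close>
    case True
    then show ?thesis using laplacian_cdist_self[OF assms(2)] by simp
  next
    case False
    then have "real (cdist V w x0 x) > 0"
      using assms(2) x cdist_eq_0_iff[of x0 x] by auto
    moreover have "K \<le> (Deg V w m x0 - laplacian V w m (\<lambda>z. real (cdist V w x0 z)) x) /
        real (cdist V w x0 x)"
      using assms(2,3) x False curvature_le[of x0 x] by force
    ultimately show ?thesis by (simp add: pos_le_divide_eq)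
  qed
qed

end
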